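(* Let $\mathcal V$ be a finite vocabulary, $L\in\mathbb N$, $\mathcal Y=\mathcal V^L$, and let $p$ be a probability distribution over $\mathcal Y$. For $\gamma>0$ let $p^\gamma$ be the temperature-scaled random sampling distribution with respect to $p$. Let $opt$ be the minimum expected cross entropy obtainable with respect to $p$. Then there exist constants $C_1,C_2,C_3\in\mathbb Z_+$ depending only on $p$ such that: for $\gamma>1$, $$\gamma C_1-opt\ \le\ \mathbb E_{y\sim p}[-\log p^\gamma(y)]-opt\ \le\ \gamma C_3+L\log|\mathcal V|-opt;$$ for $\gamma<1$, $$(L\log|\mathcal V|-opt)-\gamma C_2\ \le\ \mathbb E_{y\sim p}[-\log p^\gamma(y)]-opt\ \le\ (L\log|\mathcal V|-opt)+\gamma C_3.$$
   Context: $\mathbb Z_+=\{0,1,2,\dots\}$. For $y=y_1\cdots y_L$, $y_{[i]}=y_1\cdots y_i$ ($y_{[0]}$ empty), and $p(v\mid y_{[i-1]})$ is the conditional probability under $p$ that the $i$-th token is $v$ given that the first $i-1$ tokens are $y_{[i-1]}$. Temperature-scaled random sampling with parameter $\gamma>0$ samples tokens successively, the $i$-th one from the distribution proportional to $p(\cdot\mid y_{[i-1]})^\gamma$, so that $$p^\gamma(y)=\prod_{i=1}^L\frac{p(y_i\mid y_{[i-1]})^\gamma}{\sum_{v\in\mathcal V}p(v\mid y_{[i-1]})^\gamma}.$$ The minimum expected cross entropy is $opt=\min_q\mathbb E_{y\sim p}[-\log q(y)]$ over all probability distributions $q$ on $\mathcal Y$.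
   Formalization: The lower bound for γ<1 is stated only when p gives every sequence in V^L positive probability; without full support it fails for every C_2 as γ→0 (e.g. a point mass with |V|=2, L=1). All other bounds are for arbitrary p. *)

theory Defs
  imports "HOL-Probability.Probability"
begin

text \<open>
  Tokens are numbered from 0, so \<open>take i y\<close> holds the tokens that precede \<open>y ! i\<close>.
  If the prefix \<open>xs\<close> has probability 0 under \<open>p\<close>, the conditional probability is \<open>0 / 0 = 0\<close>.
  In \<open>temp_sampling\<close> such a prefix only occurs after a factor that is already 0.
\<close>

definition token_sequences :: "'v set \<Rightarrow> nat \<Rightarrow> 'v list set" where
  "token_sequences V L = {y. length y = L \<and> set y \<subseteq> V}"

definition next_token_prob :: "'v list pmf \<Rightarrow> 'v list \<Rightarrow> 'v \<Rightarrow> real" where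
  "next_token_prob p xs v =
     cond_prob (measure_pmf p) (\<lambda>y. y ! length xs = v) (\<lambda>y. take (length xs) y = xs)"

definition temp_sampling :: "'v set \<Rightarrow> nat \<Rightarrow> 'v list pmf \<Rightarrow> real \<Rightarrow> 'v list \<Rightarrow> real" where
  "temp_sampling V L p \<gamma> y =
     (\<Prod>i<L. next_token_prob p (take i y) (y ! i) powr \<gamma> /
            (\<Sum>v\<in>V. next_token_prob p (take i y) v powr \<gamma>))"

text \<open>
  Since \<open>ln 0 = 0\<close> in HOL, the value \<open>- log 0 = \<infinity>\<close> is set explicitly. Otherwise a distribution
  could lower its cross entropy by giving mass 0 to likely sequences. The argument is always a
  probability, so the coercion to \<^typ>\<open>ennreal\<close> cuts nothing off.
\<close>

definition neg_log :: "real \<Rightarrow> ennreal" where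
  "neg_log x = (if x = 0 then \<infinity> else ennreal (- ln x))"

definition cross_entropy :: "'a pmf \<Rightarrow> ('a \<Rightarrow> real) \<Rightarrow> ereal" where
  "cross_entropy p q = enn2ereal (\<integral>\<^sup>+ y. neg_log (q y) \<partial>measure_pmf p)"

definition opt_cross_entropy :: "'v set \<Rightarrow> nat \<Rightarrow> 'v list pmf \<Rightarrow> ereal" where
  "opt_cross_entropy V L p =
     (INF q \<in> {q. set_pmf q \<subseteq> token_sequences V L}. cross_entropy p (pmf q))"

text \<open>By Gibbs' inequality the infimum is a minimum, attained at \<open>p\<close>.\<close>

lemma finite_token_sequences: "finite V \<Longrightarrow> finite (token_sequences V L)"
  unfolding token_sequences_def
  using finite_lists_length_eq[of V L] by (simp add: conj_commute)

lemma cross_entropy_self_le: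
  assumes fin: "finite (set_pmf p)"
  shows "cross_entropy p (pmf p) \<le> cross_entropy p (pmf q)"
proof -
  let ?S = "set_pmf p"
  have ce: "(\<integral>\<^sup>+ y. neg_log (pmf r y) \<partial>measure_pmf p) = ennreal (\<Sum>y\<in>?S. - ln (pmf r y) * pmf p y)"
    if pos: "?S \<subseteq> set_pmf r" for r
  proof -
    have "(\<integral>\<^sup>+ y. neg_log (pmf r y) \<partial>measure_pmf p) = (\<Sum>y\<in>?S. neg_log (pmf r y) * ennreal (pmf p y))"
      by (rule nn_integral_measure_pmf_finite[OF fin]) simp
    also have "\<dots> = (\<Sum>y\<in>?S. ennreal (- ln (pmf r y) * pmf p y))"
      using pos by (intro sum.cong refl)
        (auto simp: neg_log_def set_pmf_iff pmf_pos ln_le_zero_iff pmf_le_1 less_le ennreal_mult'' simp flip: ennreal_mult')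
    also have "\<dots> = ennreal (\<Sum>y\<in>?S. - ln (pmf r y) * pmf p y)"
      using pos by (intro sum_ennreal)
        (auto simp: set_pmf_iff pmf_le_1 less_le intro!: mult_nonpos_nonneg)
    finally show ?thesis .
  qed
  have "(\<integral>\<^sup>+ y. neg_log (pmf p y) \<partial>measure_pmf p) \<le> (\<integral>\<^sup>+ y. neg_log (pmf q y) \<partial>measure_pmf p)"
  proof (cases "?S \<subseteq> set_pmf q")
    case True
    have "(\<Sum>y\<in>?S. - ln (pmf p y) * pmf p y) \<le> (\<Sum>y\<in>?S. - ln (pmf q y) * pmf p y + (pmf q y - pmf p y))"
    proof (rule sum_mono)
      fix y assume "y \<in> ?S"
      then have p: "pmf p y > 0" and q: "pmf q y > 0"
        using True by (auto simp: pmf_positive)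
      have "ln (pmf q y / pmf p y) \<le> pmf q y / pmf p y - 1"
        using p q by (intro ln_le_minus_one) simp
      then have "(ln (pmf q y) - ln (pmf p y)) * pmf p y \<le> (pmf q y / pmf p y - 1) * pmf p y"
        using p q by (intro mult_right_mono) (simp_all add: ln_div)
      also have "\<dots> = pmf q y - pmf p y"
        using p by (simp add: field_simps)
      finally show "- ln (pmf p y) * pmf p y \<le> - ln (pmf q y) * pmf p y + (pmf q y - pmf p y)"
        by (simp add: algebra_simps)
    qed
    also have "\<dots> = (\<Sum>y\<in>?S. - ln (pmf q y) * pmf p y) + ((\<Sum>y\<in>?S. pmf q y) - (\<Sum>y\<in>?S. pmf p y))"
      by (simp only: sum.distrib sum_subtractf)
    also have "\<dots> \<le> (\<Sum>y\<in>?S. - ln (pmf q y) * pmf p y)"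
      using fin measure_pmf.prob_le_1[of q ?S]
      by (simp add: sum_pmf_eq_1 measure_measure_pmf_finite)
    finally show ?thesis
      unfolding ce[OF True] ce[OF order_refl] by (rule ennreal_leI)
  next
    case False
    then obtain z where z: "z \<in> ?S" "pmf q z = 0"
      by (auto simp: set_pmf_iff)
    have "(\<integral>\<^sup>+ y. neg_log (pmf q y) \<partial>measure_pmf p) = (\<Sum>y\<in>?S. neg_log (pmf q y) * ennreal (pmf p y))"
      by (rule nn_integral_measure_pmf_finite[OF fin]) simp
    also have "\<dots> \<ge> neg_log (pmf q z) * ennreal (pmf p z)"
      using fin z by (intro member_le_sum) auto
    also have "neg_log (pmf q z) * ennreal (pmf p z) = \<infinity>"
      using z by (simp add: neg_log_def ennreal_top_mult pmf_positive set_pmf_iff)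
    finally show ?thesis by (simp add: top_unique)
  qed
  then show ?thesis
    unfolding cross_entropy_def by (simp add: less_eq_ennreal.rep_eq)
qed

lemma opt_cross_entropy_eq:
  assumes "finite V" "set_pmf p \<subseteq> token_sequences V L"
  shows "opt_cross_entropy V L p = cross_entropy p (pmf p)"
proof -
  have "finite (set_pmf p)"
    using assms finite_subset finite_token_sequences by blast
  then show ?thesis
    unfolding opt_cross_entropy_def
    using assms(2) by (intro antisym INF_lower INF_greatest cross_entropy_self_le) auto
qed

end

theory Submission
  imports Defs
begin

text \<open>
  Every conditional probability of a token that continues a prefix of some \<open>z\<close> is at least \<open>pmf p z\<close>,
  hence at least the least positive mass \<open>m\<close> of \<open>p\<close>, and at most 1. So every factor of
  \<open>p\<^sup>\<gamma>\<close> on the support is at least \<open>m powr \<gamma> / card V\<close>, and under full support it is at most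
  \<open>1 / (card V * m powr \<gamma>)\<close>. Both bounds on the cross entropy follow with the integer
  constant \<open>\<lceil>- L * ln m\<rceil>\<close>. The first lower bound holds with \<open>C1 = 0\<close>, since cross entropy is nonnegative.
\<close>

lemma next_token_prob_nonneg: "0 \<le> next_token_prob p xs v"
  by (simp add: next_token_prob_def cond_prob_def)

lemma next_token_prob_le_1: "next_token_prob p xs v \<le> 1"
  unfolding next_token_prob_def cond_prob_def
  by (intro divide_le_eq_1[THEN iffD2])
     (auto simp: zero_less_measure_iff intro!: measure_pmf.finite_measure_mono)

text \<open>Conditioning divides by the mass of the prefix event, which is at most 1, so the
  quotient is no smaller than the mass of the joint event, and that event contains
  \<open>z\<close>.\<close>

lemma pmf_le_next_token_prob:
  assumes "i < length z"
  shows "pmf p z \<le> next_token_prob p (take i z) (z ! i)"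
proof -
  let ?A = "{y. y ! i = z ! i \<and> take i y = take i z}" and ?B = "{y. take i y = take i z}"
  have "pmf p z \<le> measure (measure_pmf p) ?A"
    unfolding pmf.rep_eq by (rule measure_pmf.finite_measure_mono) auto
  also have "\<dots> \<le> measure (measure_pmf p) ?A / measure (measure_pmf p) ?B"
  proof (cases "measure (measure_pmf p) ?B = 0")
    \<comment> \<open>The quotient is 0 by the convention for division by 0, so \<open>?A\<close>
      must be shown to have mass 0 as well.\<close>
    case True
    have "measure (measure_pmf p) ?A \<le> measure (measure_pmf p) ?B"
      by (rule measure_pmf.finite_measure_mono) auto
    then show ?thesis using True by simp
  next
    case False
    then have "0 < measure (measure_pmf p) ?B" by (simp add: zero_less_measure_iff)
    then show ?thesis by (simp add: le_divide_eq mult_left_le)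
  qed
  finally show ?thesis
    using assms by (simp add: next_token_prob_def cond_prob_def)
qed

lemma cross_entropy_nonneg: "0 \<le> cross_entropy p q"
  by (simp add: cross_entropy_def)

text \<open>A pointwise bound on the support passes to the expectation. The sign of \<open>K\<close>
  matters: for negative \<open>K\<close> the coercion \<open>ennreal K\<close> would be 0 instead of
  \<open>K\<close>.\<close>

lemma cross_entropy_le:
  assumes "0 \<le> K" "\<And>y. y \<in> set_pmf p \<Longrightarrow> exp (- K) \<le> q y"
  shows "cross_entropy p q \<le> ereal K"
proof -
  have "neg_log (q y) \<le> ennreal K" if "y \<in> set_pmf p" for y
  proof -
    have pos: "0 < q y" using assms(2)[OF that] exp_gt_zero[of "- K"] by linarith
    then have "- K \<le> ln (q y)" using assms(2)[OF that] by (simp add: ln_ge_iff)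
    then show ?thesis using pos by (simp add: neg_log_def ennreal_leI)
  qed
  then have "(\<integral>\<^sup>+ y. neg_log (q y) \<partial>measure_pmf p) \<le> (\<integral>\<^sup>+ y. ennreal K \<partial>measure_pmf p)"
    by (intro nn_integral_mono_AE) (simp add: AE_measure_pmf_iff)
  then have "(\<integral>\<^sup>+ y. neg_log (q y) \<partial>measure_pmf p) \<le> ennreal K"
    by (simp add: measure_pmf.emeasure_space_1)
  then have "cross_entropy p q \<le> enn2ereal (ennreal K)"
    by (simp add: cross_entropy_def less_eq_ennreal.rep_eq)
  then show ?thesis using assms(1) by simp
qed

text \<open>Counterpart of \<open>cross_entropy_le\<close> with no condition on the sign of
  \<open>K\<close>: a negative bound is trivial, and a value \<open>q y = 0\<close> only helps, as
  it costs infinity.\<close>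

lemma cross_entropy_ge:
  assumes "\<And>y. y \<in> set_pmf p \<Longrightarrow> 0 \<le> q y" "\<And>y. y \<in> set_pmf p \<Longrightarrow> q y \<le> exp (- K)"
  shows "ereal K \<le> cross_entropy p q"
proof (cases "0 \<le> K")
  case True
  have "ennreal K \<le> neg_log (q y)" if y: "y \<in> set_pmf p" for y
  proof (cases "q y = 0")
    case False
    then have pos: "0 < q y" using assms(1)[OF y] by simp
    then have "ln (q y) \<le> - K" using assms(2)[OF y] ln_mono[of "q y" "exp (- K)"] by simp
    then show ?thesis using pos by (simp add: neg_log_def ennreal_leI)
  qed (simp add: neg_log_def)
  then have "(\<integral>\<^sup>+ y. ennreal K \<partial>measure_pmf p) \<le> (\<integral>\<^sup>+ y. neg_log (q y) \<partial>measure_pmf p)"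
    by (intro nn_integral_mono_AE) (simp add: AE_measure_pmf_iff)
  then have "ennreal K \<le> (\<integral>\<^sup>+ y. neg_log (q y) \<partial>measure_pmf p)"
    by (simp add: measure_pmf.emeasure_space_1)
  then have "enn2ereal (ennreal K) \<le> cross_entropy p q"
    by (simp add: cross_entropy_def less_eq_ennreal.rep_eq)
  then show ?thesis using True by simp
next
  case False
  then have "ereal K \<le> 0" by simp
  then show ?thesis using cross_entropy_nonneg order_trans by blast
qed

lemma temp_sampling_nonneg: "0 \<le> temp_sampling V L p \<gamma> y"
  unfolding temp_sampling_def by (intro prod_nonneg ballI divide_nonneg_nonneg sum_nonneg) auto

lemma sum_next_token_prob_powr_le:
  assumes "0 \<le> \<gamma>"
  shows "(\<Sum>v\<in>V. next_token_prob p xs v powr \<gamma>) \<le> real (card V)"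
proof -
  have "(\<Sum>v\<in>V. next_token_prob p xs v powr \<gamma>) \<le> (\<Sum>v\<in>V. 1)"
    using assms by (intro sum_mono powr_le1)
      (simp_all add: next_token_prob_nonneg next_token_prob_le_1)
  then show ?thesis by simp
qed

lemma temp_sampling_ge:
  assumes V: "finite V" and y: "y \<in> token_sequences V L" and m: "0 < m" "m \<le> pmf p y"
    and \<gamma>: "0 \<le> \<gamma>"
  shows "exp (- (\<gamma> * (- real L * ln m) + real L * ln (real (card V)))) \<le> temp_sampling V L p \<gamma> y"
proof -
  have len: "length y = L" and sub: "set y \<subseteq> V"
    using y by (auto simp: token_sequences_def)
  have "m powr \<gamma> / real (card V)
      \<le> next_token_prob p (take i y) (y ! i) powr \<gamma> / (\<Sum>v\<in>V. next_token_prob p (take i y) v powr \<gamma>)"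
    if "i < L" for i
  proof -
    have "m \<le> next_token_prob p (take i y) (y ! i)"
      using m(2) pmf_le_next_token_prob[of i y p] that len by simp
    \<comment> \<open>A single positive summand makes the denominator positive, as
      \<open>frac_le\<close> requires.\<close>
    moreover from this have "0 < next_token_prob p (take i y) (y ! i) powr \<gamma>" using m by simp
    moreover have "y ! i \<in> V" using that len sub by auto
    ultimately show ?thesis
      using V m \<gamma> by (intro frac_le powr_mono2 sum_next_token_prob_powr_le)
        (auto intro!: sum_pos2[of V "y ! i"])
  qed
  then have "(\<Prod>i<L. m powr \<gamma> / real (card V)) \<le> temp_sampling V L p \<gamma> y"
    unfolding temp_sampling_def by (intro prod_mono) auto
  \<comment> \<open>For \<open>L = 0\<close> both sides are 1, even with \<open>V\<close> empty.
    Otherwise the token sequence \<open>y\<close> forces \<open>V\<close> to be nonempty, so the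
    logarithm is genuine.\<close>
  moreover have "exp (- (\<gamma> * (- real L * ln m) + real L * ln (real (card V))))
      = (m powr \<gamma> / real (card V)) ^ L"
  proof (cases "L = 0")
    case False
    then have "V \<noteq> {}" using len sub by auto
    then have "0 < real (card V)" using V by (simp add: card_gt_0_iff)
    then have "m powr \<gamma> / real (card V) = exp (\<gamma> * ln m - ln (real (card V)))"
      using m by (simp add: powr_def exp_diff)
    then show ?thesis by (simp add: algebra_simps flip: exp_of_nat_mult)
  qed simp
  ultimately show ?thesis by simp
qed

text \<open>The normalizing sum runs over all tokens, also those that \<open>y\<close> does not use.
  Bounding it from below therefore takes mass at least \<open>m\<close> on every sequence, not only
  on \<open>y\<close>.\<close>

lemma temp_sampling_le:
  assumes V: "finite V" and y: "y \<in> token_sequences V L"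
    and m: "0 < m" "\<And>z. z \<in> token_sequences V L \<Longrightarrow> m \<le> pmf p z" and \<gamma>: "0 \<le> \<gamma>"
  shows "temp_sampling V L p \<gamma> y \<le> exp (- (real L * ln (real (card V)) - \<gamma> * (- real L * ln m)))"
proof -
  have len: "length y = L" and sub: "set y \<subseteq> V"
    using y by (auto simp: token_sequences_def)
  have card: "0 < real (card V)" if "0 < L"
  proof -
    from that have "V \<noteq> {}" using len sub by auto
    then show ?thesis using V by (simp add: card_gt_0_iff)
  qed
  have "next_token_prob p (take i y) (y ! i) powr \<gamma> / (\<Sum>v\<in>V. next_token_prob p (take i y) v powr \<gamma>)
      \<le> 1 / (real (card V) * m powr \<gamma>)" if i: "i < L" for i
  proof -
    \<comment> \<open>Overwriting position \<open>i\<close> by \<open>v\<close> leaves the first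
      \<open>i\<close> tokens alone and yields another sequence over \<open>V\<close>, whose mass
      bounds the conditional probability of \<open>v\<close>.\<close>
    have "m \<le> next_token_prob p (take i y) v" if v: "v \<in> V" for v
    proof -
      have "set (y[i := v]) \<subseteq> V"
        using sub v set_update_subset_insert[of y i v] by auto
      then have "m \<le> pmf p (y[i := v])"
        using len by (intro m) (simp add: token_sequences_def)
      then show ?thesis
        using pmf_le_next_token_prob[of i "y[i := v]" p] i len by simp
    qed
    then have "(\<Sum>v\<in>V. m powr \<gamma>) \<le> (\<Sum>v\<in>V. next_token_prob p (take i y) v powr \<gamma>)"
      using m(1) \<gamma> by (intro sum_mono powr_mono2) auto
    then show ?thesis
      using \<gamma> m(1) card i
      by (intro frac_le powr_le1) (auto simp: next_token_prob_nonneg next_token_prob_le_1)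
  qed
  then have "temp_sampling V L p \<gamma> y \<le> (\<Prod>i<L. 1 / (real (card V) * m powr \<gamma>))"
    unfolding temp_sampling_def by (intro prod_mono) (auto intro!: divide_nonneg_nonneg sum_nonneg)
  moreover have "exp (- (real L * ln (real (card V)) - \<gamma> * (- real L * ln m)))
      = (1 / (real (card V) * m powr \<gamma>)) ^ L"
  proof (cases "L = 0")
    case False
    then have "1 / (real (card V) * m powr \<gamma>) = exp (- ln (real (card V)) - \<gamma> * ln m)"
      using m(1) card by (simp add: powr_def exp_diff exp_minus field_simps)
    then show ?thesis by (simp add: algebra_simps flip: exp_of_nat_mult)
  qed simp
  ultimately show ?thesis by simp
qed

text \<open>Full support guards the lower bound for \<open>\<gamma> < 1\<close>: a point mass is
  unchanged by temperature and has cross entropy 0, so with \<open>L > 0\<close> and at least two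
  tokens that bound would fail as \<open>\<gamma>\<close> tends to 0.\<close>

theorem proposition7:
  fixes V :: "'v set" and L :: nat and p :: "'v list pmf"
  assumes "finite V"
    and "set_pmf p \<subseteq> token_sequences V L"
  shows "\<exists>C1 C2 C3 :: nat.
    (\<forall>\<gamma>::real. \<gamma> > 1 \<longrightarrow>
       ereal (\<gamma> * real C1) - opt_cross_entropy V L p
         \<le> cross_entropy p (temp_sampling V L p \<gamma>) - opt_cross_entropy V L p
     \<and> cross_entropy p (temp_sampling V L p \<gamma>) - opt_cross_entropy V L p
         \<le> ereal (\<gamma> * real C3) + ereal (real L * ln (real (card V))) - opt_cross_entropy V L p)
  \<and> (\<forall>\<gamma>::real. 0 < \<gamma> \<and> \<gamma> < 1 \<longrightarrow>
       (set_pmf p = token_sequences V L \<longrightarrow>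
          (ereal (real L * ln (real (card V))) - opt_cross_entropy V L p) - ereal (\<gamma> * real C2)
            \<le> cross_entropy p (temp_sampling V L p \<gamma>) - opt_cross_entropy V L p)
     \<and> cross_entropy p (temp_sampling V L p \<gamma>) - opt_cross_entropy V L p
         \<le> (ereal (real L * ln (real (card V))) - opt_cross_entropy V L p) + ereal (\<gamma> * real C3))"
proof -
  let ?S = "set_pmf p" and ?opt = "opt_cross_entropy V L p"
  let ?ce = "\<lambda>\<gamma>. cross_entropy p (temp_sampling V L p \<gamma>)"
  define U where "U = real L * ln (real (card V))"
  define m where "m = Min (pmf p ` ?S)"
  \<comment> \<open>Since \<open>0 < m \<le> 1\<close>, the rounded number is nonnegative and
    \<open>nat\<close> cuts nothing off. This \<open>C\<close> serves as both \<open>C2\<close> and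
    \<open>C3\<close>.\<close>
  define C where "C = nat \<lceil>- real L * ln m\<rceil>"
  have fin: "finite ?S"
    using assms finite_subset finite_token_sequences by blast
  have m_le: "m \<le> pmf p y" if "y \<in> ?S" for y
    unfolding m_def using fin that by simp
  have "m \<in> pmf p ` ?S"
    unfolding m_def using fin set_pmf_not_empty by (intro Min_in) auto
  then have m_pos: "0 < m" by (auto simp: pmf_positive)
  have C: "- real L * ln m \<le> real C" unfolding C_def by linarith
  have U: "0 \<le> U" unfolding U_def by (cases "card V = 0") auto
  have upper: "?ce \<gamma> \<le> ereal (\<gamma> * real C + U)" if \<gamma>: "0 < \<gamma>" for \<gamma>
  proof (rule cross_entropy_le)
    fix y assume y: "y \<in> ?S"
    have "exp (- (\<gamma> * real C + U)) \<le> exp (- (\<gamma> * (- real L * ln m) + U))"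
      using mult_left_mono[OF C, of \<gamma>] \<gamma> by simp
    also have "\<dots> \<le> temp_sampling V L p \<gamma> y"
      unfolding U_def using y assms m_pos m_le \<gamma> by (intro temp_sampling_ge) auto
    finally show "exp (- (\<gamma> * real C + U)) \<le> temp_sampling V L p \<gamma> y" .
  qed (use U \<gamma> in simp)
  have lower: "ereal (U - \<gamma> * real C) \<le> ?ce \<gamma>"
    if \<gamma>: "0 < \<gamma>" and full: "?S = token_sequences V L" for \<gamma>
  proof (rule cross_entropy_ge)
    fix y assume y: "y \<in> ?S"
    have "temp_sampling V L p \<gamma> y \<le> exp (- (U - \<gamma> * (- real L * ln m)))"
      unfolding U_def using y assms(1) m_pos m_le \<gamma> full by (intro temp_sampling_le) auto
    also have "\<dots> \<le> exp (- (U - \<gamma> * real C))"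
      using mult_left_mono[OF C, of \<gamma>] \<gamma> by simp
    finally show "temp_sampling V L p \<gamma> y \<le> exp (- (U - \<gamma> * real C))" .
  qed (rule temp_sampling_nonneg)
  have "ereal (\<gamma> * real 0) - ?opt \<le> ?ce \<gamma> - ?opt" for \<gamma>
    using cross_entropy_nonneg by (intro ereal_minus_mono) (auto simp: zero_ereal_def)
  moreover have "?ce \<gamma> - ?opt \<le> ereal (\<gamma> * real C) + ereal U - ?opt" if "0 < \<gamma>" for \<gamma>
    using upper[OF that] by (intro ereal_minus_mono) auto
  moreover have "(ereal U - ?opt) - ereal (\<gamma> * real C) \<le> ?ce \<gamma> - ?opt"
    if "0 < \<gamma>" "?S = token_sequences V L" for \<gamma>
  proof -
    \<comment> \<open>Regrouping is not free in \<open>ereal\<close>, but \<open>?opt\<close> is the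
      only term not given as a real, so a case split on it settles the identity.\<close>
    have "(ereal U - ?opt) - ereal (\<gamma> * real C) = ereal (U - \<gamma> * real C) - ?opt"
      by (cases ?opt) simp_all
    also have "\<dots> \<le> ?ce \<gamma> - ?opt"
      using lower[OF that] by (intro ereal_minus_mono) auto
    finally show ?thesis .
  qed
  moreover have "?ce \<gamma> - ?opt \<le> (ereal U - ?opt) + ereal (\<gamma> * real C)" if "0 < \<gamma>" for \<gamma>
  proof -
    have "?ce \<gamma> - ?opt \<le> ereal (\<gamma> * real C + U) - ?opt"
      using upper[OF that] by (intro ereal_minus_mono) auto
    also have "\<dots> = (ereal U - ?opt) + ereal (\<gamma> * real C)"
      by (cases ?opt) simp_all
    finally show ?thesis .
  qed
  ultimately show ?thesis
    unfolding U_def[symmetric]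
    by (intro exI[of _ "0::nat"] exI[of _ C]) auto
qed

end
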